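(* Consider a run of the IBCN method (described in the context) on a function $f:\mathbb R^n\to\mathbb R$ whose Hessian is Lipschitz continuous with constant $L>0$. Assume there exist finite constants $f^{\min}$ and $B$ such that $f(x)\ge f^{\min}$ and $\|\nabla^2 f(x)\|\le B$ for all $x$ in the level set $\mathcal L^0=\{x\in\mathbb R^n: f(x)\le f(x_0)\}$. Given $\epsilon\in(0,1]$, let $$K_\epsilon=\{k\ge0 \text{ an iteration}:\|\nabla f(x_k)\|\ge\epsilon\}.$$ Then $$|K_\epsilon\cap\mathcal S|\le\Bigl(\frac{f(x_0)-f^{\min}}{c_1}\Bigr)\epsilon^{-2},\qquad\text{where } c_1=\theta\eta_1(1-\beta)\min\Bigl\{\frac{\theta\beta}{B},\sqrt{\frac{3\theta\beta}{\sigma^{\max}}}\Bigr\}$$ and $\sigma^{\max}=\max\{\sigma_0,\ \gamma_3L/(1-\eta_2)\}$. Moreover, let $\hat k$ be the first iteration such that $\hat k\notin K_\epsilon$ (that is, the smallest nonnegative integer not in $K_\epsilon$). Then $$\hat k\le\Bigl(1+\frac{|\log\gamma_1|}{\log\gamma_2}\Bigr)\Bigl(\frac{f(x_0)-f^{\min}}{c_1}\Bigr)\epsilon^{-2}+\frac1{\log\gamma_2}\log\Bigl(\frac{\sigma^{\max}}{\sigma_0}\Bigr).$$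
   Context: Setting and notation. $f:\mathbb R^n\to\mathbb R$ is a (possibly non-convex) twice differentiable function with $\|\nabla^2 f(x)-\nabla^2 f(y)\|\le L\|x-y\|$ for all $x,y\in\mathbb R^n$, where $L>0$. $\|\cdot\|$ is the Euclidean norm for vectors and the induced operator norm for matrices. For $\mathcal I\subseteq\{1,\dots,n\}$, $U_{\mathcal I}\in\mathbb R^{n\times|\mathcal I|}$ is the submatrix of the $n\times n$ identity obtained by keeping the columns with indices in $\mathcal I$; $\nabla_{\mathcal I}f(x)=U_{\mathcal I}^T\nabla f(x)$ and $\nabla^2_{\mathcal I}f(x)=U_{\mathcal I}^T\nabla^2 f(x)U_{\mathcal I}$. The quantity $\theta\beta/B$ is read as $+\infty$ if $B=0$. IBCN method. Parameters: $x_0\in\mathbb R^n$, $\sigma^{\min}>0$, $\sigma_0\in[\sigma^{\min},\infty)$, $0<\eta_1\le\eta_2<1$, $0<\gamma_1\le1<\gamma_2\le\gamma_3$, $\tau\in[0,\infty)$, $\beta\in(0,1)$, $\theta\in(0,1]$. For $k=0,1,2,\dots$: if $\nabla f(x_k)=0$, stop; otherwise perform iteration $k$: (1) choose any block $\mathcal I_k\subseteq\{1,\dots,n\}$ with $\|\nabla_{\mathcal I_k}f(x_k)\|\ge\theta\|\nabla f(x_k)\|$; (2) define, for $s\in\mathbb R^{|\mathcal I_k|}$, $q_k(s)=f(x_k)+\nabla_{\mathcal I_k}f(x_k)^Ts+\frac12 s^T\nabla^2_{\mathcal I_k}f(x_k)s$ and $m_k(s)=q_k(s)+\frac{\sigma_k}{6}\|s\|^3$,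 and choose any $s_k\in\mathbb R^{|\mathcal I_k|}$ with $\|\nabla m_k(s_k)\|\le\tau\|s_k\|^2$ and $m_k(s_k)\le m_k(\hat s_k)$, where $\hat s_k=-\hat\alpha_k\nabla_{\mathcal I_k}f(x_k)$ and $\hat\alpha_k=\min\Bigl\{\frac{\beta}{\|\nabla^2_{\mathcal I_k}f(x_k)\|},\sqrt{\frac{3\beta}{\sigma_k\|\nabla_{\mathcal I_k}f(x_k)\|}}\Bigr\}$ (the first argument of the min is $+\infty$ when $\|\nabla^2_{\mathcal I_k}f(x_k)\|=0$); (3) compute $\rho_k=\frac{f(x_k)-f(x_k+U_{\mathcal I_k}s_k)}{q_k(0)-q_k(s_k)}$; (4) set $x_{k+1}=x_k+U_{\mathcal I_k}s_k$ if $\rho_k\ge\eta_1$, and $x_{k+1}=x_k$ otherwise; (5) choose any $\sigma_{k+1}\in[\max\{\sigma^{\min},\gamma_1\sigma_k\},\sigma_k]$ if $\rho_k\ge\eta_2$; any $\sigma_{k+1}\in[\sigma_k,\gamma_2\sigma_k]$ if $\rho_k\in[\eta_1,\eta_2)$; any $\sigma_{k+1}\in[\gamma_2\sigma_k,\gamma_3\sigma_k]$ if $\rho_k<\eta_1$. "Iteration" means an iteration that is actually performed (all $k\ge0$ if the method never stops). $\mathcal S=\{k:\rho_k\ge\eta_1\}$ is the set of successful iterations. *)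

theory Defs
  imports "HOL-Analysis.Analysis"
begin

definition grad :: "(real ^ 'n \<Rightarrow> real) \<Rightarrow> real ^ 'n \<Rightarrow> real ^ 'n" where
  "grad f x = (THE D. GDERIV f x :> D)"

definition hess :: "(real ^ 'n \<Rightarrow> real) \<Rightarrow> real ^ 'n \<Rightarrow> real ^ 'n ^ 'n" where
  "hess f x = jacobian (grad f) (at x)"

lemma grad_eqI:
  assumes "GDERIV f x :> D"
  shows "grad f x = D"
  unfolding grad_def
proof (rule the_equality)
  fix E
  assume "GDERIV f x :> E"
  with assms have "(\<lambda>h. h \<bullet> D) = (\<lambda>h. h \<bullet> E)"
    unfolding gderiv_def by (rule has_derivative_unique)
  then have "(E - D) \<bullet> E = (E - D) \<bullet> D"
    by (rule fun_cong[symmetric])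
  then have "(E - D) \<bullet> (E - D) = 0"
    by (simp only: inner_diff_right diff_self)
  then show "E = D"
    by (simp only: inner_eq_zero_iff right_minus_eq)
qed (fact assms)

definition twice_differentiable :: "(real ^ 'n \<Rightarrow> real) \<Rightarrow> bool" where
  "twice_differentiable f \<longleftrightarrow>
     (\<forall>x. f differentiable (at x)) \<and> (\<forall>x. grad f differentiable (at x))"

definition opnorm :: "real ^ 'n ^ 'm \<Rightarrow> real" where
  "opnorm A = onorm (\<lambda>v. A *v v)"

(* min {a / b, c}, where a / b is read as plus infinity if b = 0 *)
definition min_quot :: "real \<Rightarrow> real \<Rightarrow> real \<Rightarrow> real" where
  "min_quot a b c = (if b = 0 then c else min (a / b) c)"

(* The blocks vary from iteration to iteration, so R^|I| cannot be a type of its own. It is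
   represented by the coordinate subspace block_space I of R^n, isometric to R^|I| by
   padding with zeros. Correspondingly, in block_mat I the columns of the identity with
   index outside I are set to zero instead of being deleted. *)
definition block_space :: "'n set \<Rightarrow> (real ^ 'n) set" where
  "block_space I = {s. \<forall>i. i \<notin> I \<longrightarrow> s $ i = 0}"

definition block_mat :: "'n set \<Rightarrow> real ^ 'n ^ 'n" where
  "block_mat I = (\<chi> i j. if i = j \<and> j \<in> I then 1 else 0)"

definition block_grad :: "'n set \<Rightarrow> (real ^ 'n \<Rightarrow> real) \<Rightarrow> real ^ 'n \<Rightarrow> real ^ 'n" where
  "block_grad I f x = transpose (block_mat I) *v grad f x"

definition block_hess :: "'n set \<Rightarrow> (real ^ 'n \<Rightarrow> real) \<Rightarrow> real ^ 'n \<Rightarrow> real ^ 'n ^ 'n" where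
  "block_hess I f x = transpose (block_mat I) ** hess f x ** block_mat I"

(* Both models are defined by their formulas on all of R^n. At points of block_space I the
   gradient over R^n lies in block_space I and is the zero-padded gradient over R^|I|. *)
definition quad_model ::
  "(real ^ 'n \<Rightarrow> real) \<Rightarrow> 'n set \<Rightarrow> real ^ 'n \<Rightarrow> real ^ 'n \<Rightarrow> real" where
  "quad_model f I x s =
     f x + block_grad I f x \<bullet> s + (1/2) * (s \<bullet> (block_hess I f x *v s))"

definition cubic_model ::
  "(real ^ 'n \<Rightarrow> real) \<Rightarrow> 'n set \<Rightarrow> real ^ 'n \<Rightarrow> real \<Rightarrow> real ^ 'n \<Rightarrow> real" where
  "cubic_model f I x \<sigma> s = quad_model f I x s + \<sigma> / 6 * norm s ^ 3"

definition cauchy_stepsize ::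
  "real \<Rightarrow> (real ^ 'n \<Rightarrow> real) \<Rightarrow> 'n set \<Rightarrow> real ^ 'n \<Rightarrow> real \<Rightarrow> real" where
  "cauchy_stepsize \<beta> f I x \<sigma> =
     min_quot \<beta> (opnorm (block_hess I f x)) (sqrt (3 * \<beta> / (\<sigma> * norm (block_grad I f x))))"

definition cauchy_step ::
  "real \<Rightarrow> (real ^ 'n \<Rightarrow> real) \<Rightarrow> 'n set \<Rightarrow> real ^ 'n \<Rightarrow> real \<Rightarrow> real ^ 'n" where
  "cauchy_step \<beta> f I x \<sigma> = - (cauchy_stepsize \<beta> f I x \<sigma> *\<^sub>R block_grad I f x)"

definition decrease_ratio ::
  "(real ^ 'n \<Rightarrow> real) \<Rightarrow> 'n set \<Rightarrow> real ^ 'n \<Rightarrow> real ^ 'n \<Rightarrow> real" where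
  "decrease_ratio f I x s =
     (f x - f (x + block_mat I *v s)) / (quad_model f I x 0 - quad_model f I x s)"

(* A run is given by total sequences; if the method stops, their later entries are
   meaningless and unconstrained. *)
definition performed :: "(real ^ 'n \<Rightarrow> real) \<Rightarrow> (nat \<Rightarrow> real ^ 'n) \<Rightarrow> nat \<Rightarrow> bool" where
  "performed f x k \<longleftrightarrow> (\<forall>j\<le>k. grad f (x j) \<noteq> 0)"

definition ibcn_run ::
  "(real ^ 'n \<Rightarrow> real) \<Rightarrow> real \<Rightarrow> real \<Rightarrow> real \<Rightarrow> real \<Rightarrow> real \<Rightarrow> real \<Rightarrow> real \<Rightarrow> real \<Rightarrow> real
   \<Rightarrow> (nat \<Rightarrow> real ^ 'n) \<Rightarrow> (nat \<Rightarrow> 'n set) \<Rightarrow> (nat \<Rightarrow> real ^ 'n) \<Rightarrow> (nat \<Rightarrow> real) \<Rightarrow> bool" where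
  "ibcn_run f \<sigma>min \<eta>\<^sub>1 \<eta>\<^sub>2 \<gamma>\<^sub>1 \<gamma>\<^sub>2 \<gamma>\<^sub>3 \<tau> \<beta> \<theta> x I s \<sigma> \<longleftrightarrow>
    (\<forall>k. performed f x k \<longrightarrow>
      (let m = cubic_model f (I k) (x k) (\<sigma> k);
           \<rho> = decrease_ratio f (I k) (x k) (s k)
       in norm (block_grad (I k) f (x k)) \<ge> \<theta> * norm (grad f (x k))
        \<and> s k \<in> block_space (I k)
        \<and> norm (grad m (s k)) \<le> \<tau> * (norm (s k))\<^sup>2
        \<and> m (s k) \<le> m (cauchy_step \<beta> f (I k) (x k) (\<sigma> k))
        \<and> x (Suc k) = (if \<rho> \<ge> \<eta>\<^sub>1 then x k + block_mat (I k) *v s k else x k)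
        \<and> (\<rho> \<ge> \<eta>\<^sub>2 \<longrightarrow> \<sigma> (Suc k) \<in> {max \<sigma>min (\<gamma>\<^sub>1 * \<sigma> k) .. \<sigma> k})
        \<and> (\<eta>\<^sub>1 \<le> \<rho> \<and> \<rho> < \<eta>\<^sub>2 \<longrightarrow> \<sigma> (Suc k) \<in> {\<sigma> k .. \<gamma>\<^sub>2 * \<sigma> k})
        \<and> (\<rho> < \<eta>\<^sub>1 \<longrightarrow> \<sigma> (Suc k) \<in> {\<gamma>\<^sub>2 * \<sigma> k .. \<gamma>\<^sub>3 * \<sigma> k})))"

definition successful ::
  "(real ^ 'n \<Rightarrow> real) \<Rightarrow> real \<Rightarrow> (nat \<Rightarrow> real ^ 'n) \<Rightarrow> (nat \<Rightarrow> 'n set) \<Rightarrow> (nat \<Rightarrow> real ^ 'n)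
   \<Rightarrow> nat set" where
  "successful f \<eta>\<^sub>1 x I s =
     {k. performed f x k \<and> decrease_ratio f (I k) (x k) (s k) \<ge> \<eta>\<^sub>1}"

definition large_grad_iterations ::
  "(real ^ 'n \<Rightarrow> real) \<Rightarrow> (nat \<Rightarrow> real ^ 'n) \<Rightarrow> real \<Rightarrow> nat set" where
  "large_grad_iterations f x \<epsilon> = {k. performed f x k \<and> norm (grad f (x k)) \<ge> \<epsilon>}"

end

theory Submission
  imports Defs
begin

text \<open>
  On the block, the cubic term makes \<open>m\<^sub>k\<close> an upper model of \<open>f\<close> as soon as
  \<open>\<sigma>\<^sub>k \<ge> L\<close>, because a function with \<open>L\<close>-Lipschitz Hessian exceeds its
  second-order Taylor polynomial by at most \<open>L/6 \<parallel>s\<parallel>\<^sup>3\<close> (\<open>taylor_cubic_upper_bound\<close>). The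
  Cauchy step, against which \<open>s\<^sub>k\<close> is measured, has a step size tuned so that the quadratic and the cubic term of the
  model each destroy at most the fraction \<open>\<beta>/2\<close> of the first-order decrease
  (\<open>cauchy_step_decrease\<close>). Hence \<open>q\<^sub>k(0) - q\<^sub>k(s\<^sub>k)\<close> dominates both \<open>\<sigma>\<^sub>k/6 \<parallel>s\<^sub>k\<parallel>\<^sup>3\<close> and
  the Cauchy decrease, the fraction \<open>1 - \<beta>\<close> of that first-order decrease.

  The first of these bounds controls \<open>\<sigma>\<^sub>k\<close>: once \<open>\<sigma>\<^sub>k \<ge> L/(1 - \<eta>\<^sub>2)\<close>, the Taylor error is
  at most the fraction \<open>1 - \<eta>\<^sub>2\<close> of the predicted decrease, so \<open>\<rho>\<^sub>k \<ge> \<eta>\<^sub>2\<close> and \<open>\<sigma>\<^sub>k\<close> does not grow.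
  Growth can overshoot that threshold by a factor \<open>\<gamma>\<^sub>3\<close> at most, whence \<open>\<sigma>\<^sub>k \<le> \<sigma>max\<close>
  (\<open>sigma_le_max\<close>). The second bound then gives a decrease of \<open>f\<close> by at least \<open>c\<^sub>1 \<epsilon>\<^sup>2\<close> at each
  successful iteration with a large gradient (\<open>sufficient_decrease\<close>). All iterates stay in the
  level set, where \<open>f \<ge> fmin\<close>, so there are at most \<open>(f(x\<^sub>0) - fmin)/(c\<^sub>1 \<epsilon>\<^sup>2)\<close> of
  them.

  Unsuccessful iterations are paid for by \<open>\<sigma>\<close>: each multiplies it by at least \<open>\<gamma>\<^sub>2\<close>, a
  successful one shrinks it by a factor of \<open>\<gamma>\<^sub>1\<close> at worst, and it never exceeds
  \<open>\<sigma>max\<close>. Taking logarithms bounds the number of unsuccessful iterations in terms of that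
  of the successful ones (\<open>iterations_le_successes\<close>), which gives the bound on the first iteration
  outside \<open>K\<^sub>\<epsilon>\<close>.
\<close>

section \<open>Operator norm and coordinate blocks\<close>

lemma norm_mult_vec_le_opnorm: "norm (A *v v) \<le> opnorm A * norm v"
  unfolding opnorm_def by (intro onorm matrix_vector_mul_bounded_linear)

lemma opnorm_nonneg: "opnorm A \<ge> 0"
  unfolding opnorm_def by (intro onorm_pos_le matrix_vector_mul_bounded_linear)

lemma abs_quadratic_form_le_opnorm: "\<bar>v \<bullet> (A *v v)\<bar> \<le> opnorm A * (norm v)\<^sup>2"
proof -
  have "\<bar>v \<bullet> (A *v v)\<bar> \<le> norm v * norm (A *v v)"
    by (rule Cauchy_Schwarz_ineq2)
  also have "\<dots> \<le> norm v * (opnorm A * norm v)"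
    by (intro mult_left_mono norm_mult_vec_le_opnorm norm_ge_zero)
  finally show ?thesis by (simp add: power2_eq_square mult_ac)
qed

lemma block_mat_mult_nth: "(block_mat I *v v) $ i = (if i \<in> I then v $ i else 0)"
proof -
  have "(block_mat I *v v) $ i = (\<Sum>j\<in>UNIV. if j = i then (if i \<in> I then v $ i else 0) else 0)"
    unfolding matrix_vector_mult_def block_mat_def vec_lambda_beta by (intro sum.cong) auto
  then show ?thesis by simp
qed

lemma transpose_block_mat: "transpose (block_mat I) = block_mat I"
  by (auto simp: transpose_def block_mat_def vec_eq_iff)

lemma block_mat_mult_block_space: "s \<in> block_space I \<Longrightarrow> block_mat I *v s = s"
  by (auto simp: vec_eq_iff block_mat_mult_nth block_space_def)

lemma norm_block_mat_mult_le: "norm (block_mat I *v v) \<le> norm v"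
  by (rule norm_le_componentwise_cart) (simp add: block_mat_mult_nth)

lemma inner_block_mat_mult: "(block_mat I *v v) \<bullet> w = v \<bullet> (block_mat I *v w)"
  by (metis dot_lmul_matrix transpose_block_mat vector_transpose_matrix)

lemma opnorm_block_hess_le: "opnorm (block_hess I f x) \<le> opnorm (hess f x)"
  unfolding opnorm_def [of "block_hess I f x"]
proof (rule onorm_le)
  fix v
  have "norm (block_hess I f x *v v) \<le> norm (hess f x *v (block_mat I *v v))"
    by (simp add: block_hess_def transpose_block_mat norm_block_mat_mult_le
        flip: matrix_vector_mul_assoc)
  also have "\<dots> \<le> opnorm (hess f x) * norm (block_mat I *v v)"
    by (rule norm_mult_vec_le_opnorm)
  also have "\<dots> \<le> opnorm (hess f x) * norm v"
    by (intro mult_left_mono norm_block_mat_mult_le opnorm_nonneg)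
  finally show "norm (block_hess I f x *v v) \<le> opnorm (hess f x) * norm v" .
qed

text \<open>On the block the model is the second-order Taylor polynomial of \<open>f\<close> itself, so Taylor
  estimates apply to it unchanged.\<close>

lemma quad_model_block_space:
  assumes "s \<in> block_space I"
  shows "quad_model f I x s = f x + grad f x \<bullet> s + (1/2) * (s \<bullet> (hess f x *v s))"
  using assms
  by (simp add: quad_model_def block_grad_def block_hess_def transpose_block_mat
      inner_block_mat_mult block_mat_mult_block_space
      flip: matrix_vector_mul_assoc inner_block_mat_mult[of I s])

section \<open>Taylor's upper bound for a Lipschitz continuous Hessian\<close>

lemma grad_has_derivative:
  assumes "f differentiable (at x)"
  shows "(f has_derivative (\<lambda>h. h \<bullet> grad f x)) (at x)"
proof -
  obtain D where D: "(f has_derivative D) (at x)"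
    using assms by (auto simp: differentiable_def)
  have "linear D" using D by (rule has_derivative_linear)
  then have "D h = h \<bullet> adjoint D 1" for h
    using adjoint_works[of D h 1] by simp
  then have "D = (\<lambda>h. h \<bullet> adjoint D 1)" by auto
  then have "GDERIV f x :> adjoint D 1"
    using D by (simp add: gderiv_def)
  then show ?thesis
    using grad_eqI by (metis gderiv_def)
qed

lemma hess_has_derivative:
  assumes "grad f differentiable (at x)"
  shows "(grad f has_derivative (\<lambda>h. hess f x *v h)) (at x)"
  using assms jacobian_works unfolding hess_def by blast

text \<open>Along the segment from \<open>x\<close> to \<open>x + s\<close>, the function minus its claimed upper bound has
  value and slope zero at the start and, by the Lipschitz condition, a nonpositive second
  derivative. Two monotonicity arguments therefore replace the usual integral remainder, for
  which integrability of the Hessian would be needed.\<close>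

lemma taylor_cubic_upper_bound:
  fixes f :: "real ^ 'n \<Rightarrow> real"
  assumes "twice_differentiable f"
    and lip: "\<And>y z. opnorm (hess f y - hess f z) \<le> L * norm (y - z)"
  shows "f (x + s) \<le> f x + grad f x \<bullet> s + (1/2) * (s \<bullet> (hess f x *v s)) + L / 6 * norm s ^ 3"
proof -
  have df: "(f has_derivative (\<lambda>h. h \<bullet> grad f y)) (at y)" for y
    using assms(1) by (auto simp: twice_differentiable_def intro: grad_has_derivative)
  have dg: "(grad f has_derivative (\<lambda>h. hess f y *v h)) (at y)" for y
    using assms(1) by (auto simp: twice_differentiable_def intro: hess_has_derivative)
  define \<psi> where "\<psi> t = f (x + t *\<^sub>R s) - f x - t * (grad f x \<bullet> s)
    - t\<^sup>2 / 2 * (s \<bullet> (hess f x *v s)) - L / 6 * t ^ 3 * norm s ^ 3" for t :: real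
  define \<psi>1 where "\<psi>1 t = grad f (x + t *\<^sub>R s) \<bullet> s - grad f x \<bullet> s
    - t * (s \<bullet> (hess f x *v s)) - L / 2 * t\<^sup>2 * norm s ^ 3" for t :: real
  define \<psi>2 where "\<psi>2 t = (hess f (x + t *\<^sub>R s) *v s) \<bullet> s
    - (s \<bullet> (hess f x *v s)) - L * t * norm s ^ 3" for t :: real
  have line: "((\<lambda>t. x + t *\<^sub>R s) has_derivative (\<lambda>h. h *\<^sub>R s)) (at t)" for t :: real
    by (auto intro!: derivative_eq_intros)
  have "((\<lambda>t. f (x + t *\<^sub>R s)) has_real_derivative (grad f (x + t *\<^sub>R s) \<bullet> s)) (at t)" for t
    using has_derivative_compose[OF line df]
    by (simp add: has_field_derivative_def inner_commute mult_commute_abs)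
  then have d\<psi>: "(\<psi> has_real_derivative \<psi>1 t) (at t)" for t
    unfolding \<psi>_def \<psi>1_def
    by (auto intro!: derivative_eq_intros simp: power2_eq_square)
  have "((\<lambda>t. grad f (x + t *\<^sub>R s) \<bullet> s) has_real_derivative
      ((hess f (x + t *\<^sub>R s) *v s) \<bullet> s)) (at t)" for t
    using has_derivative_inner_left[OF has_derivative_compose[OF line dg], of s]
    by (simp add: has_field_derivative_def mult_commute_abs matrix_vector_mult_scaleR)
  then have d\<psi>1: "(\<psi>1 has_real_derivative \<psi>2 t) (at t)" for t
    unfolding \<psi>1_def \<psi>2_def
    by (auto intro!: derivative_eq_intros)
  have \<psi>2: "\<psi>2 t \<le> 0" if "t \<ge> 0" for t
  proof -
    have "s \<bullet> ((hess f (x + t *\<^sub>R s) - hess f x) *v s)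
        \<le> opnorm (hess f (x + t *\<^sub>R s) - hess f x) * (norm s)\<^sup>2"
      using abs_quadratic_form_le_opnorm abs_le_D1 by blast
    also have "\<dots> \<le> (L * norm (t *\<^sub>R s)) * (norm s)\<^sup>2"
      using lip[of "x + t *\<^sub>R s" x] by (intro mult_right_mono) auto
    also have "\<dots> = L * t * norm s ^ 3"
      using that by (simp add: power2_eq_square power3_eq_cube)
    finally show ?thesis
      by (simp add: \<psi>2_def matrix_vector_mult_diff_rdistrib inner_diff_right inner_commute)
  qed
  have \<psi>1: "\<psi>1 t \<le> 0" if "t \<ge> 0" for t
  proof -
    have "\<psi>1 t \<le> \<psi>1 0"
      using that d\<psi>1 \<psi>2 by (intro DERIV_nonpos_imp_nonincreasing[of 0 t \<psi>1]) auto
    then show ?thesis by (simp add: \<psi>1_def)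
  qed
  have "\<psi> 1 \<le> \<psi> 0"
    using d\<psi> \<psi>1 by (intro DERIV_nonpos_imp_nonincreasing[of 0 1 \<psi>]) auto
  then show ?thesis by (simp add: \<psi>_def)
qed

section \<open>The Cauchy step\<close>

lemma min_quot_pos: "0 < a \<Longrightarrow> 0 \<le> b \<Longrightarrow> 0 < c \<Longrightarrow> 0 < min_quot a b c"
  by (auto simp: min_quot_def)

lemma min_quot_le: "min_quot a b c \<le> c"
  by (auto simp: min_quot_def)

lemma min_quot_mult_le: "0 \<le> a \<Longrightarrow> 0 \<le> b \<Longrightarrow> min_quot a b c * b \<le> a"
  by (auto simp: min_quot_def min_def field_simps)

lemma min_quot_mono:
  assumes "0 \<le> a" "a \<le> a'" "0 \<le> b'" "b' \<le> b" "c \<le> c'"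
  shows "min_quot a b c \<le> min_quot a' b' c'"
proof (cases "b' = 0")
  case True
  then show ?thesis using assms by (auto simp: min_quot_def)
next
  case False
  then have "a / b \<le> a' / b'" using assms by (intro frac_le) auto
  then show ?thesis using assms False by (auto simp: min_quot_def)
qed

lemma mult_min_quot: "0 < t \<Longrightarrow> t * min_quot a b c = min_quot (t * a) b (t * c)"
  by (auto simp: min_quot_def min_mult_distrib_left)

text \<open>The step size caps \<open>\<alpha> \<parallel>H\<parallel>\<close> by \<open>\<beta>\<close> and \<open>\<sigma> \<alpha>\<^sup>2 \<parallel>g\<parallel>\<close> by \<open>3 \<beta>\<close>. The quadratic and the
  cubic term of the model then each cost at most \<open>\<beta>/2\<close> of the linear decrease
  \<open>\<alpha> \<parallel>g\<parallel>\<^sup>2\<close>.\<close>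

lemma cauchy_step_decrease:
  assumes "0 < \<beta>" "0 < \<sigma>" "block_grad I f x \<noteq> 0"
  shows "cubic_model f I x \<sigma> (cauchy_step \<beta> f I x \<sigma>)
    \<le> f x - (1 - \<beta>) * (cauchy_stepsize \<beta> f I x \<sigma> * (norm (block_grad I f x))\<^sup>2)"
proof -
  define g where "g = block_grad I f x"
  define H where "H = block_hess I f x"
  define \<alpha> where "\<alpha> = cauchy_stepsize \<beta> f I x \<sigma>"
  have \<alpha>_eq: "\<alpha> = min_quot \<beta> (opnorm H) (sqrt (3 * \<beta> / (\<sigma> * norm g)))"
    by (simp add: \<alpha>_def cauchy_stepsize_def g_def H_def)
  have g: "norm g > 0" using assms by (simp add: g_def)
  have \<alpha>: "\<alpha> > 0"
    unfolding \<alpha>_eq using assms g by (intro min_quot_pos opnorm_nonneg) auto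
  have \<alpha>H: "\<alpha> * opnorm H \<le> \<beta>"
    unfolding \<alpha>_eq using assms by (intro min_quot_mult_le opnorm_nonneg) auto
  have "\<alpha>\<^sup>2 \<le> (sqrt (3 * \<beta> / (\<sigma> * norm g)))\<^sup>2"
    using \<alpha> min_quot_le unfolding \<alpha>_eq by (intro power_mono) auto
  also have "\<dots> = 3 * \<beta> / (\<sigma> * norm g)"
    using assms g by simp
  finally have \<alpha>\<sigma>: "\<sigma> * \<alpha>\<^sup>2 * norm g \<le> 3 * \<beta>"
    using assms g by (simp add: field_simps)
  have quad: "\<alpha>\<^sup>2 * (g \<bullet> (H *v g)) \<le> \<beta> * (\<alpha> * (norm g)\<^sup>2)"
  proof -
    have "g \<bullet> (H *v g) \<le> opnorm H * (norm g)\<^sup>2"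
      using abs_quadratic_form_le_opnorm abs_le_D1 by blast
    then have "\<alpha>\<^sup>2 * (g \<bullet> (H *v g)) \<le> \<alpha>\<^sup>2 * (opnorm H * (norm g)\<^sup>2)"
      by (intro mult_left_mono) auto
    also have "\<dots> = (\<alpha> * opnorm H) * (\<alpha> * (norm g)\<^sup>2)"
      by (simp add: power2_eq_square)
    also have "\<dots> \<le> \<beta> * (\<alpha> * (norm g)\<^sup>2)"
      using \<alpha> \<alpha>H by (intro mult_right_mono) auto
    finally show ?thesis .
  qed
  have cubic: "\<sigma> * (\<alpha> * norm g) ^ 3 \<le> 3 * \<beta> * (\<alpha> * (norm g)\<^sup>2)"
  proof -
    have "\<sigma> * (\<alpha> * norm g) ^ 3 = (\<sigma> * \<alpha>\<^sup>2 * norm g) * (\<alpha> * (norm g)\<^sup>2)"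
      by (simp add: power2_eq_square power3_eq_cube)
    also have "\<dots> \<le> 3 * \<beta> * (\<alpha> * (norm g)\<^sup>2)"
      using \<alpha> \<alpha>\<sigma> by (intro mult_right_mono) auto
    finally show ?thesis .
  qed
  have step: "cauchy_step \<beta> f I x \<sigma> = (- \<alpha>) *\<^sub>R g"
    by (simp add: cauchy_step_def \<alpha>_def g_def)
  have "cubic_model f I x \<sigma> (cauchy_step \<beta> f I x \<sigma>)
      = f x - \<alpha> * (g \<bullet> g) + (1/2) * (\<alpha>\<^sup>2 * (g \<bullet> (H *v g))) + \<sigma> / 6 * (\<alpha> * norm g) ^ 3"
    using \<alpha> unfolding cubic_model_def quad_model_def step
    by (simp del: scaleR_minus_left flip: g_def H_def
        add: matrix_vector_mult_scaleR power2_eq_square)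
  also have "\<dots> \<le> f x - \<alpha> * (norm g)\<^sup>2 + (1/2) * (\<beta> * (\<alpha> * (norm g)\<^sup>2))
      + (1/6) * (3 * \<beta> * (\<alpha> * (norm g)\<^sup>2))"
    unfolding power2_norm_eq_inner[symmetric] using quad cubic by linarith
  also have "\<dots> = f x - (1 - \<beta>) * (\<alpha> * (norm g)\<^sup>2)"
    by (simp add: algebra_simps)
  finally show ?thesis by (simp add: g_def \<alpha>_def)
qed

text \<open>Both arguments of the minimum in \<open>\<alpha> \<parallel>g\<parallel>\<close> grow with \<open>\<parallel>g\<parallel>\<close>: the first linearly, the
  second like a square root. Since \<open>\<epsilon> \<le> 1\<close>, the linear rate is the weaker one and can be factored
  out of both, which yields the order \<open>\<epsilon>\<^sup>2\<close>.\<close>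

lemma cauchy_decrease_lower_bound:
  assumes "0 < \<beta>" "0 < \<theta>" "0 < \<epsilon>" "\<epsilon> \<le> 1" "0 < \<sigma>" "\<sigma> \<le> \<sigma>max"
    and g: "\<theta> * \<epsilon> \<le> norm (block_grad I f x)"
    and H: "opnorm (block_hess I f x) \<le> B"
  shows "\<theta> * min_quot (\<theta> * \<beta>) B (sqrt (3 * \<theta> * \<beta> / \<sigma>max)) * \<epsilon>\<^sup>2
    \<le> cauchy_stepsize \<beta> f I x \<sigma> * (norm (block_grad I f x))\<^sup>2"
proof -
  define G where "G = norm (block_grad I f x)"
  define h where "h = opnorm (block_hess I f x)"
  define M where "M = min_quot (\<theta> * \<beta>) B (sqrt (3 * \<theta> * \<beta> / \<sigma>max))"
  have h: "0 \<le> h" "h \<le> B" using H opnorm_nonneg by (auto simp: h_def)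
  have "0 < \<theta> * \<epsilon>" using assms by simp
  then have G: "\<theta> * \<epsilon> \<le> G" "0 < G" using g by (auto simp: G_def)
  have "0 < M"
    unfolding M_def using assms h by (intro min_quot_pos) auto
  have sq: "G * sqrt (3 * \<beta> / (\<sigma> * G)) = sqrt (3 * \<beta> * G / \<sigma>)"
  proof -
    have "G * sqrt (3 * \<beta> / (\<sigma> * G)) = sqrt (G\<^sup>2 * (3 * \<beta> / (\<sigma> * G)))"
      using G real_sqrt_mult[of "G\<^sup>2" "3 * \<beta> / (\<sigma> * G)"] by simp
    also have "G\<^sup>2 * (3 * \<beta> / (\<sigma> * G)) = 3 * \<beta> * G / \<sigma>"
      using G assms by (simp add: power2_eq_square field_simps)
    finally show ?thesis .
  qed
  have sq_le: "\<epsilon> * sqrt (3 * \<theta> * \<beta> / \<sigma>max) \<le> sqrt (3 * \<beta> * G / \<sigma>)"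
  proof -
    have "\<epsilon> * sqrt (3 * \<theta> * \<beta> / \<sigma>max) = sqrt (\<epsilon>\<^sup>2 * (3 * \<theta> * \<beta> / \<sigma>max))"
      using assms real_sqrt_mult[of "\<epsilon>\<^sup>2" "3 * \<theta> * \<beta> / \<sigma>max"] by simp
    also have "\<dots> \<le> sqrt (3 * \<beta> * G / \<sigma>)"
    proof (rule real_sqrt_le_mono)
      have "\<epsilon>\<^sup>2 \<le> \<epsilon>" using assms by (simp add: power2_eq_square mult_left_le)
      then have "\<epsilon>\<^sup>2 * (3 * \<theta> * \<beta> / \<sigma>max) \<le> \<epsilon> * (3 * \<theta> * \<beta> / \<sigma>max)"
        using assms by (intro mult_right_mono) auto
      also have "\<dots> = 3 * \<beta> * (\<theta> * \<epsilon>) / \<sigma>max" by simp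
      also have "\<dots> \<le> 3 * \<beta> * G / \<sigma>"
        using assms G by (intro frac_le mult_left_mono) auto
      finally show "\<epsilon>\<^sup>2 * (3 * \<theta> * \<beta> / \<sigma>max) \<le> 3 * \<beta> * G / \<sigma>" .
    qed
    finally show ?thesis .
  qed
  have "\<epsilon> * M = min_quot (\<epsilon> * (\<theta> * \<beta>)) B (\<epsilon> * sqrt (3 * \<theta> * \<beta> / \<sigma>max))"
    unfolding M_def using assms by (intro mult_min_quot)
  also have "\<dots> \<le> min_quot (G * \<beta>) h (sqrt (3 * \<beta> * G / \<sigma>))"
    using assms h sq_le mult_right_mono[OF G(1), of \<beta>]
    by (intro min_quot_mono) (auto simp: mult_ac)
  also have "\<dots> = G * cauchy_stepsize \<beta> f I x \<sigma>"
    using G sq by (simp add: mult_min_quot cauchy_stepsize_def flip: G_def h_def)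
  finally have "(\<theta> * \<epsilon>) * (\<epsilon> * M) \<le> G * (G * cauchy_stepsize \<beta> f I x \<sigma>)"
    by (rule mult_mono[OF G(1)]) (use G \<open>0 < M\<close> assms in auto)
  then show ?thesis
    by (simp add: M_def power2_eq_square mult_ac flip: G_def)
qed

section \<open>Counting iterations through the regularization parameter\<close>

text \<open>On a logarithmic scale, \<open>\<sigma>\<close> loses at most \<open>\<bar>ln \<gamma>\<^sub>1\<bar>\<close> at an index in \<open>S\<close>, gains at least
  \<open>ln \<gamma>\<^sub>2\<close> at every other index, and gains at most \<open>ln (\<sigma>max / \<sigma> 0)\<close> altogether.\<close>

lemma iterations_le_successes:
  fixes \<sigma> :: "nat \<Rightarrow> real"
  assumes "0 < \<sigma> 0" "0 < \<gamma>\<^sub>1" "\<gamma>\<^sub>1 \<le> 1" "1 < \<gamma>\<^sub>2"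
    and succ: "\<And>k. k < N \<Longrightarrow> k \<in> S \<Longrightarrow> \<gamma>\<^sub>1 * \<sigma> k \<le> \<sigma> (Suc k)"
    and fail: "\<And>k. k < N \<Longrightarrow> k \<notin> S \<Longrightarrow> \<gamma>\<^sub>2 * \<sigma> k \<le> \<sigma> (Suc k)"
    and "\<sigma> N \<le> \<sigma>max"
  shows "real N \<le> (1 + \<bar>ln \<gamma>\<^sub>1\<bar> / ln \<gamma>\<^sub>2) * real (card (S \<inter> {..<N}))
    + 1 / ln \<gamma>\<^sub>2 * ln (\<sigma>max / \<sigma> 0)"
proof -
  define a where "a n = real (card (S \<inter> {..<n}))" for n
  have a_Suc: "a (Suc n) = a n + (if n \<in> S then 1 else 0)" for n
    by (simp add: a_def lessThan_Suc Int_insert_right)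
  have "0 < \<sigma> n \<and> ln (\<sigma> 0) + a n * ln \<gamma>\<^sub>1 + (real n - a n) * ln \<gamma>\<^sub>2 \<le> ln (\<sigma> n)"
    if "n \<le> N" for n
    using that
  proof (induction n)
    case 0
    then show ?case using assms by (simp add: a_def)
  next
    case (Suc n)
    then have pos: "0 < \<sigma> n"
      and IH: "ln (\<sigma> 0) + a n * ln \<gamma>\<^sub>1 + (real n - a n) * ln \<gamma>\<^sub>2 \<le> ln (\<sigma> n)"
      by auto
    define \<gamma> where "\<gamma> = (if n \<in> S then \<gamma>\<^sub>1 else \<gamma>\<^sub>2)"
    have "0 < \<gamma>" using assms by (simp add: \<gamma>_def)
    then have "0 < \<gamma> * \<sigma> n" using pos by simp
    moreover have le: "\<gamma> * \<sigma> n \<le> \<sigma> (Suc n)"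
      using succ[of n] fail[of n] Suc.prems by (simp add: \<gamma>_def)
    ultimately have pos': "0 < \<sigma> (Suc n)" by linarith
    have "ln \<gamma> + ln (\<sigma> n) = ln (\<gamma> * \<sigma> n)"
      using \<open>0 < \<gamma>\<close> pos by (simp add: ln_mult)
    also have "\<dots> \<le> ln (\<sigma> (Suc n))"
      using le \<open>0 < \<gamma> * \<sigma> n\<close> pos' by simp
    finally show ?case
      using IH pos' by (auto simp: a_Suc \<gamma>_def algebra_simps split: if_splits)
  qed
  from this[of N] have "0 < \<sigma> N"
    and ln: "ln (\<sigma> 0) + a N * ln \<gamma>\<^sub>1 + (real N - a N) * ln \<gamma>\<^sub>2 \<le> ln (\<sigma> N)"
    by auto
  have "ln (\<sigma> N) \<le> ln \<sigma>max" using \<open>0 < \<sigma> N\<close> assms by simp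
  moreover have "ln (\<sigma>max / \<sigma> 0) = ln \<sigma>max - ln (\<sigma> 0)"
    using \<open>0 < \<sigma> N\<close> assms by (simp add: ln_div)
  moreover have "\<bar>ln \<gamma>\<^sub>1\<bar> = - ln \<gamma>\<^sub>1" using assms by simp
  ultimately have "real N * ln \<gamma>\<^sub>2 \<le> a N * (ln \<gamma>\<^sub>2 + \<bar>ln \<gamma>\<^sub>1\<bar>) + ln (\<sigma>max / \<sigma> 0)"
    using ln by (simp add: algebra_simps)
  moreover have "0 < ln \<gamma>\<^sub>2" using assms by simp
  ultimately have "real N \<le> (a N * (ln \<gamma>\<^sub>2 + \<bar>ln \<gamma>\<^sub>1\<bar>) + ln (\<sigma>max / \<sigma> 0)) / ln \<gamma>\<^sub>2"
    by (simp add: pos_le_divide_eq)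
  also have "\<dots> = (1 + \<bar>ln \<gamma>\<^sub>1\<bar> / ln \<gamma>\<^sub>2) * a N + 1 / ln \<gamma>\<^sub>2 * ln (\<sigma>max / \<sigma> 0)"
    using \<open>0 < ln \<gamma>\<^sub>2\<close> by (simp add: field_simps)
  finally show ?thesis by (simp add: a_def)
qed

section \<open>Runs of the method\<close>

locale ibcn =
  fixes f :: "real ^ 'n \<Rightarrow> real"
    and x s :: "nat \<Rightarrow> real ^ 'n" and I :: "nat \<Rightarrow> 'n set" and \<sigma> :: "nat \<Rightarrow> real"
    and L \<sigma>min \<eta>\<^sub>1 \<eta>\<^sub>2 \<gamma>\<^sub>1 \<gamma>\<^sub>2 \<gamma>\<^sub>3 \<tau> \<beta> \<theta> fmin B :: real
  assumes smooth: "twice_differentiable f"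
    and L: "L > 0"
    and lipschitz: "\<forall>y z. opnorm (hess f y - hess f z) \<le> L * norm (y - z)"
    and \<sigma>: "\<sigma>min > 0" "\<sigma> 0 \<ge> \<sigma>min"
    and \<eta>: "0 < \<eta>\<^sub>1" "\<eta>\<^sub>1 \<le> \<eta>\<^sub>2" "\<eta>\<^sub>2 < 1"
    and \<gamma>: "0 < \<gamma>\<^sub>1" "\<gamma>\<^sub>1 \<le> 1" "1 < \<gamma>\<^sub>2" "\<gamma>\<^sub>2 \<le> \<gamma>\<^sub>3"
    and \<beta>: "0 < \<beta>" "\<beta> < 1"
    and \<theta>: "0 < \<theta>"
    and run: "ibcn_run f \<sigma>min \<eta>\<^sub>1 \<eta>\<^sub>2 \<gamma>\<^sub>1 \<gamma>\<^sub>2 \<gamma>\<^sub>3 \<tau> \<beta> \<theta> x I s \<sigma>"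
    and level: "\<forall>y. f y \<le> f (x 0) \<longrightarrow> f y \<ge> fmin \<and> opnorm (hess f y) \<le> B"
begin

abbreviation "iter \<equiv> performed f x"
abbreviation "g k \<equiv> block_grad (I k) f (x k)"
abbreviation "\<rho> k \<equiv> decrease_ratio f (I k) (x k) (s k)"
abbreviation "\<alpha> k \<equiv> cauchy_stepsize \<beta> f (I k) (x k) (\<sigma> k)"
abbreviation "pred k \<equiv> quad_model f (I k) (x k) 0 - quad_model f (I k) (x k) (s k)"

definition \<sigma>max where "\<sigma>max = max (\<sigma> 0) (\<gamma>\<^sub>3 * L / (1 - \<eta>\<^sub>2))"
definition c\<^sub>1 where
  "c\<^sub>1 = \<theta> * \<eta>\<^sub>1 * (1 - \<beta>) * min_quot (\<theta> * \<beta>) B (sqrt (3 * \<theta> * \<beta> / \<sigma>max))"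

lemma run_step:
  assumes "iter k"
  shows "\<theta> * norm (grad f (x k)) \<le> norm (g k)"
    and "s k \<in> block_space (I k)"
    and "cubic_model f (I k) (x k) (\<sigma> k) (s k)
      \<le> cubic_model f (I k) (x k) (\<sigma> k) (cauchy_step \<beta> f (I k) (x k) (\<sigma> k))"
    and "x (Suc k) = (if \<rho> k \<ge> \<eta>\<^sub>1 then x k + s k else x k)"
    and "\<rho> k \<ge> \<eta>\<^sub>2 \<Longrightarrow> \<sigma> (Suc k) \<in> {max \<sigma>min (\<gamma>\<^sub>1 * \<sigma> k) .. \<sigma> k}"
    and "\<eta>\<^sub>1 \<le> \<rho> k \<Longrightarrow> \<rho> k < \<eta>\<^sub>2 \<Longrightarrow> \<sigma> (Suc k) \<in> {\<sigma> k .. \<gamma>\<^sub>2 * \<sigma> k}"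
    and "\<rho> k < \<eta>\<^sub>1 \<Longrightarrow> \<sigma> (Suc k) \<in> {\<gamma>\<^sub>2 * \<sigma> k .. \<gamma>\<^sub>3 * \<sigma> k}"
proof -
  note * = run[unfolded ibcn_run_def Let_def, rule_format, OF assms]
  show "s k \<in> block_space (I k)" using * by blast
  then show "x (Suc k) = (if \<rho> k \<ge> \<eta>\<^sub>1 then x k + s k else x k)"
    using * by (simp add: block_mat_mult_block_space)
qed (use run[unfolded ibcn_run_def Let_def, rule_format, OF assms] in blast)+

lemma block_grad_pos: "iter k \<Longrightarrow> 0 < norm (g k)"
proof -
  assume "iter k"
  then have "0 < \<theta> * norm (grad f (x k))" using \<theta> by (simp add: performed_def)
  also have "\<dots> \<le> norm (g k)" by (rule run_step(1)[OF \<open>iter k\<close>])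
  finally show ?thesis .
qed

text \<open>If the method stops, the parameters are still controlled at the last iterate, where no
  iteration is performed. Hence the hypothesis concerns only the indices before \<open>k\<close>.\<close>

lemma sigma_ge_min: "(\<And>j. j < k \<Longrightarrow> iter j) \<Longrightarrow> \<sigma>min \<le> \<sigma> k"
proof (induction k)
  case 0
  show ?case by (rule \<sigma>)
next
  case (Suc k)
  then have *: "iter k" "\<sigma>min \<le> \<sigma> k" by auto
  have "\<sigma> k \<le> \<gamma>\<^sub>2 * \<sigma> k" using \<gamma> * \<sigma> by simp
  then show ?case
    using run_step(5-7)[OF *(1)] * by (cases "\<rho> k \<ge> \<eta>\<^sub>2"; cases "\<rho> k \<ge> \<eta>\<^sub>1") auto
qed

lemma iter_mono: "iter k \<Longrightarrow> j \<le> k \<Longrightarrow> iter j"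
  by (auto simp: performed_def)

lemma sigma_pos: "iter k \<Longrightarrow> 0 < \<sigma> k"
  using sigma_ge_min[of k] \<sigma>(1) iter_mono[of k] by (meson less_imp_le less_le_trans)

lemma cauchy_decrease_pos: "iter k \<Longrightarrow> 0 < (1 - \<beta>) * (\<alpha> k * (norm (g k))\<^sup>2)"
proof -
  assume k: "iter k"
  have "0 < \<alpha> k"
    unfolding cauchy_stepsize_def using \<beta> sigma_pos[OF k] block_grad_pos[OF k]
    by (intro min_quot_pos opnorm_nonneg) auto
  then show ?thesis using \<beta> block_grad_pos[OF k] by simp
qed

text \<open>The step decreases \<open>m\<close> at least as much as the Cauchy step does. Since \<open>m\<close> exceeds \<open>q\<close> by
  the cubic term, the decrease of \<open>q\<close> is larger by that term.\<close>

lemma predicted_decrease: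
  assumes "iter k"
  shows "\<sigma> k / 6 * norm (s k) ^ 3 + (1 - \<beta>) * (\<alpha> k * (norm (g k))\<^sup>2) \<le> pred k"
proof -
  have "cubic_model f (I k) (x k) (\<sigma> k) (s k) \<le> f (x k) - (1 - \<beta>) * (\<alpha> k * (norm (g k))\<^sup>2)"
    using run_step(3)[OF assms] cauchy_step_decrease[of \<beta> "\<sigma> k" "I k" f "x k"]
      \<beta> sigma_pos[OF assms] block_grad_pos[OF assms] by auto
  moreover have "quad_model f (I k) (x k) 0 = f (x k)"
    by (simp add: quad_model_def)
  ultimately show ?thesis by (simp add: cubic_model_def)
qed

lemma cubic_term_le_pred: "iter k \<Longrightarrow> \<sigma> k / 6 * norm (s k) ^ 3 \<le> pred k"
  using predicted_decrease cauchy_decrease_pos by fastforce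

lemma cauchy_decrease_le_pred: "iter k \<Longrightarrow> (1 - \<beta>) * (\<alpha> k * (norm (g k))\<^sup>2) \<le> pred k"
proof -
  assume k: "iter k"
  have "0 \<le> \<sigma> k / 6 * norm (s k) ^ 3" using sigma_pos[OF k] by simp
  then show ?thesis using predicted_decrease[OF k] by linarith
qed

lemma pred_pos: "iter k \<Longrightarrow> 0 < pred k"
  using cauchy_decrease_pos cauchy_decrease_le_pred by fastforce

text \<open>The predicted decrease exceeds the actual one by at most the Taylor error
  \<open>L/6 \<parallel>s\<parallel>\<^sup>3\<close>, and it is itself at least \<open>\<sigma>/6 \<parallel>s\<parallel>\<^sup>3\<close>; so \<open>1 - \<rho> \<le> L/\<sigma>\<close>.\<close>

lemma very_successful_if_sigma_large:
  assumes k: "iter k" and large: "L / (1 - \<eta>\<^sub>2) \<le> \<sigma> k"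
  shows "\<eta>\<^sub>2 \<le> \<rho> k"
proof -
  have L_le: "L \<le> (1 - \<eta>\<^sub>2) * \<sigma> k"
    using large \<eta> by (simp add: field_simps)
  have "f (x k + s k) \<le> quad_model f (I k) (x k) (s k) + L / 6 * norm (s k) ^ 3"
    using taylor_cubic_upper_bound[OF smooth, of L "x k" "s k"] lipschitz
    by (simp add: quad_model_block_space[OF run_step(2)[OF k]])
  then have "pred k - L / 6 * norm (s k) ^ 3 \<le> f (x k) - f (x k + s k)"
    by (simp add: quad_model_def)
  moreover have "L / 6 * norm (s k) ^ 3 \<le> (1 - \<eta>\<^sub>2) * pred k"
  proof -
    have "L / 6 * norm (s k) ^ 3 = L * (norm (s k) ^ 3 / 6)" by simp
    also have "\<dots> \<le> (1 - \<eta>\<^sub>2) * \<sigma> k * (norm (s k) ^ 3 / 6)"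
      using L_le by (intro mult_right_mono) auto
    also have "\<dots> = (1 - \<eta>\<^sub>2) * (\<sigma> k / 6 * norm (s k) ^ 3)" by simp
    also have "\<dots> \<le> (1 - \<eta>\<^sub>2) * pred k"
      using cubic_term_le_pred[OF k] \<eta> by (intro mult_left_mono) auto
    finally show ?thesis .
  qed
  ultimately have "\<eta>\<^sub>2 * pred k \<le> f (x k) - f (x k + s k)"
    by (simp add: algebra_simps)
  then show ?thesis
    using pred_pos[OF k] run_step(2)[OF k]
    by (simp add: decrease_ratio_def block_mat_mult_block_space pos_le_divide_eq)
qed

text \<open>The parameter grows only from values below the threshold \<open>L / (1 - \<eta>\<^sub>2)\<close>, and then by a
  factor of at most \<open>\<gamma>\<^sub>3\<close>.\<close>

lemma sigma_le_max: "(\<And>j. j < k \<Longrightarrow> iter j) \<Longrightarrow> \<sigma> k \<le> \<sigma>max"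
proof (induction k)
  case 0
  then show ?case by (simp add: \<sigma>max_def)
next
  case (Suc k)
  then have k: "iter k" "\<sigma> k \<le> \<sigma>max" by auto
  show ?case
  proof (cases "\<eta>\<^sub>2 \<le> \<rho> k")
    case True
    then show ?thesis using run_step(5)[OF k(1)] k(2) by auto
  next
    case False
    then have "\<sigma> k \<le> L / (1 - \<eta>\<^sub>2)"
      using very_successful_if_sigma_large[OF k(1)] by linarith
    then have "\<gamma>\<^sub>3 * \<sigma> k \<le> \<gamma>\<^sub>3 * (L / (1 - \<eta>\<^sub>2))"
      using \<gamma> by (intro mult_left_mono) auto
    moreover have "\<gamma>\<^sub>2 * \<sigma> k \<le> \<gamma>\<^sub>3 * \<sigma> k"
      using \<gamma> sigma_pos[OF k(1)] by (intro mult_right_mono) auto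
    ultimately have "\<sigma> (Suc k) \<le> \<gamma>\<^sub>3 * (L / (1 - \<eta>\<^sub>2))"
      using run_step(6,7)[OF k(1)] False by (cases "\<eta>\<^sub>1 \<le> \<rho> k") auto
    then show ?thesis by (simp add: \<sigma>max_def)
  qed
qed

lemma decrease_if_successful:
  assumes "iter k" "\<eta>\<^sub>1 \<le> \<rho> k"
  shows "\<eta>\<^sub>1 * pred k \<le> f (x k) - f (x (Suc k))"
  using assms pred_pos[OF assms(1)] run_step(2,4)[OF assms(1)]
  by (simp add: decrease_ratio_def block_mat_mult_block_space pos_le_divide_eq)

lemma f_Suc_le: "iter k \<Longrightarrow> f (x (Suc k)) \<le> f (x k)"
proof -
  assume k: "iter k"
  have "0 < \<eta>\<^sub>1 * pred k" using \<eta> pred_pos[OF k] by simp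
  then show ?thesis
    using decrease_if_successful[OF k] run_step(4)[OF k] by (cases "\<eta>\<^sub>1 \<le> \<rho> k") auto
qed

lemma f_le_initial: "(\<And>j. j < k \<Longrightarrow> iter j) \<Longrightarrow> f (x k) \<le> f (x 0)"
proof (induction k)
  case (Suc k)
  then show ?case using f_Suc_le[of k] by fastforce
qed simp

lemma c1_pos: "0 < c\<^sub>1"
proof -
  have "0 \<le> opnorm (hess f (x 0))" by (rule opnorm_nonneg)
  also have "\<dots> \<le> B" using level by simp
  finally have "0 \<le> B" .
  moreover have "0 < \<sigma>max" using \<sigma> by (simp add: \<sigma>max_def less_max_iff_disj)
  ultimately have "0 < min_quot (\<theta> * \<beta>) B (sqrt (3 * \<theta> * \<beta> / \<sigma>max))"
    using \<theta> \<beta> by (intro min_quot_pos) auto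
  then show ?thesis using \<theta> \<eta> \<beta> by (simp add: c\<^sub>1_def)
qed

text \<open>A successful step achieves the fraction \<open>\<eta>\<^sub>1\<close> of the predicted decrease, hence of the
  Cauchy decrease. The curvature that enters its step size is bounded by \<open>B\<close> because rejected
  steps leave \<open>f\<close> unchanged and accepted ones lower it, so that \<open>x k\<close> lies in the level set.\<close>

lemma sufficient_decrease:
  assumes "0 < \<epsilon>" "\<epsilon> \<le> 1"
    and k: "k \<in> large_grad_iterations f x \<epsilon> \<inter> successful f \<eta>\<^sub>1 x I s"
  shows "c\<^sub>1 * \<epsilon>\<^sup>2 \<le> f (x k) - f (x (Suc k))"
proof -
  have iter: "iter k" and succ: "\<eta>\<^sub>1 \<le> \<rho> k" and eps: "\<epsilon> \<le> norm (grad f (x k))"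
    using k by (auto simp: large_grad_iterations_def successful_def)
  have before: "iter j" if "j < k" for j
    using that iter iter_mono by (meson less_imp_le)
  have "\<theta> * \<epsilon> \<le> \<theta> * norm (grad f (x k))" using eps \<theta> by simp
  also have "\<dots> \<le> norm (g k)" by (rule run_step(1)[OF iter])
  finally have large: "\<theta> * \<epsilon> \<le> norm (g k)" .
  have "opnorm (block_hess (I k) f (x k)) \<le> opnorm (hess f (x k))"
    by (rule opnorm_block_hess_le)
  also have "\<dots> \<le> B" using level f_le_initial[OF before] by simp
  finally have curv: "opnorm (block_hess (I k) f (x k)) \<le> B" .
  have "\<theta> * min_quot (\<theta> * \<beta>) B (sqrt (3 * \<theta> * \<beta> / \<sigma>max)) * \<epsilon>\<^sup>2 \<le> \<alpha> k * (norm (g k))\<^sup>2"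
    using \<beta> \<theta> assms sigma_pos[OF iter] sigma_le_max[OF before] large curv
    by (intro cauchy_decrease_lower_bound) auto
  then have "\<eta>\<^sub>1 * ((1 - \<beta>) * (\<theta> * min_quot (\<theta> * \<beta>) B (sqrt (3 * \<theta> * \<beta> / \<sigma>max)) * \<epsilon>\<^sup>2))
      \<le> \<eta>\<^sub>1 * ((1 - \<beta>) * (\<alpha> k * (norm (g k))\<^sup>2))"
    using \<eta> \<beta> by (intro mult_left_mono) auto
  also have "\<dots> \<le> \<eta>\<^sub>1 * pred k"
    using \<eta> cauchy_decrease_le_pred[OF iter] by (intro mult_left_mono) auto
  also have "\<dots> \<le> f (x k) - f (x (Suc k))"
    by (rule decrease_if_successful[OF iter succ])
  finally show ?thesis by (simp add: c\<^sub>1_def mult_ac)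
qed

lemma successes_before_decrease:
  assumes "0 < \<epsilon>" "\<epsilon> \<le> 1" and "\<And>j. j < N \<Longrightarrow> iter j"
  shows "c\<^sub>1 * \<epsilon>\<^sup>2 * real (card (large_grad_iterations f x \<epsilon> \<inter> successful f \<eta>\<^sub>1 x I s \<inter> {..<N}))
    \<le> f (x 0) - f (x N)"
  using assms(3)
proof (induction N)
  case (Suc N)
  let ?A = "large_grad_iterations f x \<epsilon> \<inter> successful f \<eta>\<^sub>1 x I s"
  have IH: "c\<^sub>1 * \<epsilon>\<^sup>2 * real (card (?A \<inter> {..<N})) \<le> f (x 0) - f (x N)"
    using Suc by simp
  show ?case
  proof (cases "N \<in> ?A")
    case True
    then have "card (?A \<inter> {..<Suc N}) = Suc (card (?A \<inter> {..<N}))"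
      by (simp add: lessThan_Suc Int_insert_right)
    then show ?thesis
      using IH sufficient_decrease[OF assms(1,2) True] by (simp add: algebra_simps)
  next
    case False
    then have "?A \<inter> {..<Suc N} = ?A \<inter> {..<N}"
      by (auto simp: less_Suc_eq)
    then show ?thesis
      using IH f_Suc_le[of N] Suc.prems by fastforce
  qed
qed simp

text \<open>The telescoped decrease reaches only finite parts of \<open>A\<close>. The bound on their size does not
  depend on the part, and so makes \<open>A\<close> itself finite.\<close>

lemma card_successes_le:
  assumes "0 < \<epsilon>" "\<epsilon> \<le> 1"
  defines "A \<equiv> large_grad_iterations f x \<epsilon> \<inter> successful f \<eta>\<^sub>1 x I s"
  shows "finite A" and "real (card A) \<le> (f (x 0) - fmin) / c\<^sub>1 * (1 / \<epsilon>\<^sup>2)"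
proof -
  define M where "M = (f (x 0) - fmin) / c\<^sub>1 * (1 / \<epsilon>\<^sup>2)"
  have bound: "real (card F) \<le> M" if F: "F \<subseteq> A" "finite F" for F
  proof (cases "F = {}")
    case True
    then show ?thesis
      using level c1_pos by (simp add: M_def)
  next
    case False
    define N where "N = Suc (Max F)"
    have "Max F \<in> A" using F False Max_in by blast
    then have "iter (Max F)" by (simp add: A_def successful_def)
    then have iters: "iter j" if "j < N" for j
      using that iter_mono by (simp add: N_def less_Suc_eq_le)
    have "F \<subseteq> A \<inter> {..<N}"
      using F by (auto simp: N_def less_Suc_eq_le)
    then have "card F \<le> card (A \<inter> {..<N})" by (intro card_mono) auto
    then have "c\<^sub>1 * \<epsilon>\<^sup>2 * real (card F) \<le> c\<^sub>1 * \<epsilon>\<^sup>2 * real (card (A \<inter> {..<N}))"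
      using c1_pos by (intro mult_left_mono) auto
    also have "\<dots> \<le> f (x 0) - f (x N)"
      unfolding A_def using assms(1,2) iters by (rule successes_before_decrease)
    also have "\<dots> \<le> f (x 0) - fmin"
      using level f_le_initial[OF iters] by simp
    finally show ?thesis
      using c1_pos assms by (simp add: M_def field_simps)
  qed
  show "finite A"
  proof (rule ccontr)
    assume "infinite A"
    then obtain F where "F \<subseteq> A" "finite F" "card F = Suc (nat \<lfloor>M\<rfloor>)"
      using infinite_arbitrarily_large by blast
    then show False using bound[of F] by linarith
  qed
  then show "real (card A) \<le> (f (x 0) - fmin) / c\<^sub>1 * (1 / \<epsilon>\<^sup>2)"
    using bound[of A] by (simp add: M_def)
qed

text \<open>Stated for every initial segment of large-gradient iterations rather than for the first
  index outside, so that it also shows that such an index exists.\<close>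

lemma large_grad_prefix_le:
  assumes "0 < \<epsilon>" "\<epsilon> \<le> 1" and prefix: "{..<N} \<subseteq> large_grad_iterations f x \<epsilon>"
  shows "real N \<le> (1 + \<bar>ln \<gamma>\<^sub>1\<bar> / ln \<gamma>\<^sub>2) * ((f (x 0) - fmin) / c\<^sub>1) * (1 / \<epsilon>\<^sup>2)
    + 1 / ln \<gamma>\<^sub>2 * ln (\<sigma>max / \<sigma> 0)"
proof -
  let ?S = "successful f \<eta>\<^sub>1 x I s"
  let ?A = "large_grad_iterations f x \<epsilon> \<inter> ?S"
  have iters: "iter k" if "k < N" for k
    using that prefix by (auto simp: large_grad_iterations_def)
  have "real N \<le> (1 + \<bar>ln \<gamma>\<^sub>1\<bar> / ln \<gamma>\<^sub>2) * real (card (?S \<inter> {..<N}))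
      + 1 / ln \<gamma>\<^sub>2 * ln (\<sigma>max / \<sigma> 0)"
  proof (rule iterations_le_successes)
    show "\<gamma>\<^sub>1 * \<sigma> k \<le> \<sigma> (Suc k)" if "k < N" "k \<in> ?S" for k
    proof -
      have "\<gamma>\<^sub>1 * \<sigma> k \<le> \<sigma> k" using \<gamma> sigma_pos[OF iters[OF that(1)]] by simp
      then show ?thesis
        using run_step(5,6)[OF iters[OF that(1)]] that(2)
        by (cases "\<eta>\<^sub>2 \<le> \<rho> k") (auto simp: successful_def)
    qed
    show "\<gamma>\<^sub>2 * \<sigma> k \<le> \<sigma> (Suc k)" if "k < N" "k \<notin> ?S" for k
      using run_step(7)[OF iters[OF that(1)]] that iters by (auto simp: successful_def)
  qed (use \<sigma> \<gamma> sigma_le_max[OF iters] in auto)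
  also have "real (card (?S \<inter> {..<N})) \<le> (f (x 0) - fmin) / c\<^sub>1 * (1 / \<epsilon>\<^sup>2)"
  proof -
    have "card (?S \<inter> {..<N}) \<le> card ?A"
      using card_successes_le(1)[OF assms(1,2)] prefix by (intro card_mono) auto
    then show ?thesis using card_successes_le(2)[OF assms(1,2)] by linarith
  qed
  finally show ?thesis
    using \<gamma> by (simp add: mult_left_mono mult.assoc)
qed

end

section \<open>Iteration complexity\<close>

theorem theorem14:
  fixes f :: "real ^ 'n \<Rightarrow> real"
    and x s :: "nat \<Rightarrow> real ^ 'n" and I :: "nat \<Rightarrow> 'n set" and \<sigma> :: "nat \<Rightarrow> real"
    and L \<sigma>min \<eta>\<^sub>1 \<eta>\<^sub>2 \<gamma>\<^sub>1 \<gamma>\<^sub>2 \<gamma>\<^sub>3 \<tau> \<beta> \<theta> fmin B \<epsilon> \<sigma>max c\<^sub>1 :: real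
    and K S :: "nat set"
  assumes "twice_differentiable f"
    and "L > 0"
    and "\<forall>y z. opnorm (hess f y - hess f z) \<le> L * norm (y - z)"
    and "\<sigma>min > 0" and "\<sigma> 0 \<ge> \<sigma>min"
    and "0 < \<eta>\<^sub>1" and "\<eta>\<^sub>1 \<le> \<eta>\<^sub>2" and "\<eta>\<^sub>2 < 1"
    and "0 < \<gamma>\<^sub>1" and "\<gamma>\<^sub>1 \<le> 1" and "1 < \<gamma>\<^sub>2" and "\<gamma>\<^sub>2 \<le> \<gamma>\<^sub>3"
    and "\<tau> \<ge> 0"
    and "0 < \<beta>" and "\<beta> < 1"
    and "0 < \<theta>" and "\<theta> \<le> 1"
    and "ibcn_run f \<sigma>min \<eta>\<^sub>1 \<eta>\<^sub>2 \<gamma>\<^sub>1 \<gamma>\<^sub>2 \<gamma>\<^sub>3 \<tau> \<beta> \<theta> x I s \<sigma>"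
    and "\<forall>y. f y \<le> f (x 0) \<longrightarrow> f y \<ge> fmin \<and> opnorm (hess f y) \<le> B"
    and "0 < \<epsilon>" and "\<epsilon> \<le> 1"
    and "K = large_grad_iterations f x \<epsilon>"
    and "S = successful f \<eta>\<^sub>1 x I s"
    and "\<sigma>max = max (\<sigma> 0) (\<gamma>\<^sub>3 * L / (1 - \<eta>\<^sub>2))"
    and "c\<^sub>1 = \<theta> * \<eta>\<^sub>1 * (1 - \<beta>) * min_quot (\<theta> * \<beta>) B (sqrt (3 * \<theta> * \<beta> / \<sigma>max))"
  shows "finite (K \<inter> S)
    \<and> real (card (K \<inter> S)) \<le> (f (x 0) - fmin) / c\<^sub>1 * (1 / \<epsilon>\<^sup>2)
    \<and> (\<exists>k. k \<notin> K)
    \<and> real (LEAST k. k \<notin> K)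
        \<le> (1 + \<bar>ln \<gamma>\<^sub>1\<bar> / ln \<gamma>\<^sub>2) * ((f (x 0) - fmin) / c\<^sub>1) * (1 / \<epsilon>\<^sup>2)
           + 1 / ln \<gamma>\<^sub>2 * ln (\<sigma>max / \<sigma> 0)"
proof -
  interpret run: ibcn f x s I \<sigma> L \<sigma>min \<eta>\<^sub>1 \<eta>\<^sub>2 \<gamma>\<^sub>1 \<gamma>\<^sub>2 \<gamma>\<^sub>3 \<tau> \<beta> \<theta> fmin B
    by unfold_locales (use assms in auto)
  have \<sigma>max: "run.\<sigma>max = \<sigma>max"
    by (simp add: assms run.\<sigma>max_def)
  have c\<^sub>1: "run.c\<^sub>1 = c\<^sub>1"
    unfolding run.c\<^sub>1_def \<sigma>max by (simp add: assms)
  note successes = run.card_successes_le[OF \<open>0 < \<epsilon>\<close> \<open>\<epsilon> \<le> 1\<close>]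
  define R where "R = (1 + \<bar>ln \<gamma>\<^sub>1\<bar> / ln \<gamma>\<^sub>2) * ((f (x 0) - fmin) / c\<^sub>1) * (1 / \<epsilon>\<^sup>2)
    + 1 / ln \<gamma>\<^sub>2 * ln (\<sigma>max / \<sigma> 0)"
  have prefix: "real N \<le> R" if "{..<N} \<subseteq> K" for N
    using run.large_grad_prefix_le[OF \<open>0 < \<epsilon>\<close> \<open>\<epsilon> \<le> 1\<close>, of N] that
    by (simp add: R_def \<sigma>max c\<^sub>1 \<open>K = large_grad_iterations f x \<epsilon>\<close>)
  have "\<exists>k. k \<notin> K"
  proof (rule ccontr)
    assume "\<not> (\<exists>k. k \<notin> K)"
    then have "real (Suc (nat \<lfloor>R\<rfloor>)) \<le> R" by (intro prefix) auto
    then show False by linarith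
  qed
  moreover have "real (LEAST k. k \<notin> K) \<le> R"
    by (rule prefix) (use not_less_Least in blast)
  ultimately show ?thesis
    using successes by (simp add: R_def c\<^sub>1 \<open>K = large_grad_iterations f x \<epsilon>\<close>
        \<open>S = successful f \<eta>\<^sub>1 x I s\<close>)
qed

end
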